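(* Let $\mathcal{P}$ be the set of all primes. Assume Goldbach's conjecture, i.e. that every even integer greater than $2$ can be expressed as the sum of two primes. Then the diameter of $C_{\mathcal{P}}$ is $3$.
   Context: For a set $P$ of positive integers, let $S_P=\bigcup_{a\in P}\{\pm a^i : i\in\mathbb{Z}_{\ge 0}\}$ (so $\pm 1\in S_P$ whenever $P\neq\emptyset$). $C_P$ denotes the Cayley graph of the additive group $\mathbb{Z}$ with generating set $S_P$: its vertices are the integers, and $x,y\in\mathbb{Z}$ are joined by an edge whenever $x+s=y$ for some $s\in S_P$. It carries the shortest-path metric $d_{S_P}$ in which every edge has length $1$. The diameter of $C_P$ is the supremum of the distances $d_{S_P}(x,y)$ over all $x,y\in\mathbb{Z}$. *)

theory Defs
  imports
    "HOL-Computational_Algebra.Primes"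
    "Graph_Theory.Pair_Digraph"
    "Graph_Theory.Shortest_Path"
begin

definition power_gens :: "nat set \<Rightarrow> int set" where
  "power_gens P = (\<Union>a\<in>P. (\<Union>i. {int a ^ i, - (int a ^ i)}))"

text \<open>As usual in the graph library, an undirected graph is a symmetric digraph: each edge
  is represented by its two arcs. The lemma \<open>symmetric_power_cayley\<close> below shows that the
  Cayley graphs considered here are symmetric.\<close>

definition int_cayley_graph :: "int set \<Rightarrow> int pair_pre_digraph" where
  "int_cayley_graph S = \<lparr> pverts = UNIV, parcs = {(x, y). \<exists>s\<in>S. x + s = y} \<rparr>"

definition power_cayley :: "nat set \<Rightarrow> (int, int \<times> int) pre_digraph" where
  "power_cayley P = with_proj (int_cayley_graph (power_gens P))"

text \<open>The infimum of the lengths of the walks from \<open>x\<close> to \<open>y\<close>, every arc having length 1;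
  it is \<open>\<infinity>\<close> if there is no walk. The library constant is specified for
  well-formed digraphs only; see \<open>wf_power_cayley\<close> below.\<close>

definition graph_dist :: "('a, 'b) pre_digraph \<Rightarrow> 'a \<Rightarrow> 'a \<Rightarrow> ereal" where
  "graph_dist G x y = wf_digraph.\<mu> G (\<lambda>_. 1) x y"

definition graph_diameter :: "('a, 'b) pre_digraph \<Rightarrow> ereal" where
  "graph_diameter G = (SUP x\<in>verts G. SUP y\<in>verts G. graph_dist G x y)"

definition goldbach_conjecture :: bool where
  "goldbach_conjecture \<longleftrightarrow>
    (\<forall>n::nat. even n \<and> n > 2 \<longrightarrow> (\<exists>p q. prime p \<and> prime q \<and> n = p + q))"

lemma wf_power_cayley: "wf_digraph (power_cayley P)"
  by unfold_locales (simp_all add: power_cayley_def int_cayley_graph_def)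

lemma power_gens_uminus: "s \<in> power_gens P \<Longrightarrow> - s \<in> power_gens P"
  unfolding power_gens_def by force

lemma symmetric_power_cayley: "symmetric (power_cayley P)"
proof -
  have "(y, x) \<in> parcs (int_cayley_graph (power_gens P))"
    if arc: "(x, y) \<in> parcs (int_cayley_graph (power_gens P))" for x y
  proof -
    obtain s where "s \<in> power_gens P" "x + s = y"
      using arc by (auto simp: int_cayley_graph_def)
    then have "- s \<in> power_gens P" "y + - s = x"
      by (auto intro: power_gens_uminus)
    then show ?thesis
      unfolding int_cayley_graph_def by auto
  qed
  then show ?thesis
    by (simp add: symmetric_def sym_def power_cayley_def)
qed

end

theory Submission
  imports Defs "HOL-Number_Theory.Cong"
begin

text \<open>
  Since the graph is a Cayley graph, the distance from \<open>x\<close> to \<open>y\<close> is the least number of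
  signed prime powers with sum \<open>y - x\<close>. The theorem therefore says that three
  signed prime powers always suffice and that two do not.

  The upper bound is where Goldbach's conjecture enters: it writes an even number greater than 2
  as a sum of two primes, 0 and 2 are immediate, and an odd number needs one more summand,
  the generator \<open>1\<close> (\<open>goldbach_three_summands\<close>).

  The lower bound is unconditional and follows Cohen and Selfridge: some odd integer \<open>n\<close> is not
  a sum of two signed prime powers. One summand of such an odd sum would be even, hence
  \<open>c * 2 ^ k\<close> with \<open>c = 1\<close> or \<open>c = - 1\<close>, so it must be shown that \<open>n - c * 2 ^ k\<close> is never a
  signed prime power. This is done with covering congruences. For each of the two signs \<open>c\<close>, the
  exponents \<open>k\<close> are covered by finitely many residue classes \<open>r\<close> modulo \<open>d\<close>, and to each class
  belongs a prime \<open>p\<close> with \<open>2 ^ d = 1\<close> and \<open>n = c * 2 ^ r\<close> modulo \<open>p\<close>. Then \<open>p\<close> divides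
  \<open>n - c * 2 ^ k\<close> for every \<open>k\<close> in the class, so the only prime powers left to exclude are the
  powers of \<open>p\<close> itself. They are excluded by a second congruence: for a suitable small modulus
  \<open>q\<close>, the numbers \<open>c * 2 ^ k + p ^ b\<close> with \<open>k\<close> in the class miss the residue of \<open>n\<close> modulo \<open>q\<close>,
  and so do the numbers \<open>c * 2 ^ k - p ^ b\<close> for another modulus. As powers are periodic, each of
  these claims is a finite computation. The lemma \<open>covers_imp_not_sum\<close> turns
  a table of such classes into the statement about all \<open>k\<close>, \<open>p\<close> and \<open>b\<close>; the tables
  \<open>pos_classes\<close> and \<open>neg_classes\<close> serve the two signs. Finally \<open>n\<close> has two distinct
  prime factors, so that it is not a generator either.
\<close>

section \<open>Walks in the Cayley graph\<close>

lemma power_cayley_simps: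
  "verts (power_cayley P) = UNIV"
  "arcs (power_cayley P) = {(x, y). y - x \<in> power_gens P}"
  "tail (power_cayley P) = fst"
  "head (power_cayley P) = snd"
proof -
  have "(\<exists>s\<in>power_gens P. x + s = y) \<longleftrightarrow> y - x \<in> power_gens P" for x y
    by (metis add_diff_cancel_left' diff_add_cancel add.commute)
  then show "arcs (power_cayley P) = {(x, y). y - x \<in> power_gens P}"
    by (simp add: power_cayley_def int_cayley_graph_def)
qed (simp_all add: power_cayley_def int_cayley_graph_def)

lemma awalk_power_cayley_iff:
  "(\<exists>p. pre_digraph.awalk (power_cayley P) x p y \<and> length p = m) \<longleftrightarrow>
   (\<exists>ss. set ss \<subseteq> power_gens P \<and> length ss = m \<and> y = x + sum_list ss)"
proof (induction m arbitrary: x)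
  case 0
  show ?case
    by (auto simp: wf_digraph.awalk_Nil_iff[OF wf_power_cayley] power_cayley_simps)
next
  case (Suc m)
  interpret wf_digraph "power_cayley P" by (rule wf_power_cayley)
  have step: "awalk x (e # p) y \<longleftrightarrow>
      (\<exists>s\<in>power_gens P. e = (x, x + s) \<and> awalk (x + s) p y)" for e p
    by (cases e) (auto simp: awalk_Cons_iff power_cayley_simps intro: rev_bexI)
  have "(\<exists>p. awalk x p y \<and> length p = Suc m) \<longleftrightarrow>
      (\<exists>s\<in>power_gens P. \<exists>p. awalk (x + s) p y \<and> length p = m)"
    unfolding length_Suc_conv using step by blast
  also have "\<dots> \<longleftrightarrow> (\<exists>s\<in>power_gens P. \<exists>ss. set ss \<subseteq> power_gens P \<and> length ss = m \<and>
      y = x + s + sum_list ss)"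
    using Suc.IH by simp
  also have "\<dots> \<longleftrightarrow> (\<exists>ss. set ss \<subseteq> power_gens P \<and> length ss = Suc m \<and> y = x + sum_list ss)"
    unfolding length_Suc_conv
    by (auto simp: add.assoc) (metis insert_subset list.simps(15) sum_list.Cons, blast)
  finally show ?case .
qed

lemma graph_dist_power_cayley_le:
  assumes "set ss \<subseteq> power_gens P" and "y = x + sum_list ss"
  shows "graph_dist (power_cayley P) x y \<le> length ss"
proof -
  interpret wf_digraph "power_cayley P" by (rule wf_power_cayley)
  obtain p where "awalk x p y" and "length p = length ss"
    using awalk_power_cayley_iff[of P x y "length ss"] assms by blast
  moreover have "awalk_cost (\<lambda>_. 1) p = length p"
    by (simp add: awalk_cost_def sum_list_triv)
  ultimately show ?thesis
    unfolding graph_dist_def using min_cost_le_walk_cost[of x p y "\<lambda>_. 1"] by simp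
qed

lemma graph_dist_power_cayley_ge:
  assumes "\<And>ss. set ss \<subseteq> power_gens P \<Longrightarrow> y = x + sum_list ss \<Longrightarrow> m \<le> length ss"
  shows "graph_dist (power_cayley P) x y \<ge> m"
proof -
  interpret wf_digraph "power_cayley P" by (rule wf_power_cayley)
  have "ereal m \<le> awalk_cost (\<lambda>_. 1) p" if walk: "awalk x p y" for p
  proof -
    obtain ss where "set ss \<subseteq> power_gens P" "length ss = length p" "y = x + sum_list ss"
      using awalk_power_cayley_iff[of P x y "length p"] walk by blast
    then have "m \<le> length p"
      using assms by metis
    then show ?thesis
      by (simp add: awalk_cost_def sum_list_triv)
  qed
  then show ?thesis
    unfolding graph_dist_def \<mu>_def by (intro INF_greatest) auto
qed

section \<open>The upper bound\<close>

lemma power_gensI: "a \<in> P \<Longrightarrow> int a ^ i \<in> power_gens P"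
  unfolding power_gens_def by auto

lemma prime_in_power_gens: "prime p \<Longrightarrow> int p \<in> power_gens {p. prime p}"
  using power_gensI[of p "{p. prime p}" 1] by simp

lemma one_in_power_gens: "1 \<in> power_gens {p. prime p}"
  using power_gensI[of 2 "{p. prime p}" 0] two_is_prime_nat by simp

lemma goldbach_three_summands_nat:
  assumes "goldbach_conjecture"
  shows "\<exists>ss. set ss \<subseteq> power_gens {p. prime p} \<and> length ss \<le> 3 \<and> int n = sum_list ss"
proof -
  let ?S = "power_gens {p. prime p}"
  have even: "\<exists>ss. set ss \<subseteq> ?S \<and> length ss \<le> 2 \<and> int m = sum_list ss" if m: "even m" for m
  proof -
    consider "m = 0" | "m = 2" | "m > 2"
      using m by (cases "m \<le> 2") (auto simp: le_Suc_eq numeral_2_eq_2)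
    then show ?thesis
    proof cases
      case 1
      then show ?thesis by (intro exI[of _ "[]"]) simp
    next
      case 2
      then show ?thesis using one_in_power_gens by (intro exI[of _ "[1, 1]"]) simp
    next
      case 3
      then obtain p q where "prime p" "prime q" "m = p + q"
        using assms m unfolding goldbach_conjecture_def by blast
      then show ?thesis
        using prime_in_power_gens by (intro exI[of _ "[int p, int q]"]) simp
    qed
  qed
  show ?thesis
  proof (cases "even n")
    case True
    then show ?thesis using even[of n] by fastforce
  next
    case False
    then obtain m where "even m" and n: "n = Suc m"
      by (cases n) auto
    then obtain ss where "set ss \<subseteq> ?S" "length ss \<le> 2" "int m = sum_list ss"
      using even by blast
    then show ?thesis
      using one_in_power_gens by (intro exI[of _ "1 # ss"]) (simp add: n)
  qed
qed

text \<open>The generators are closed under negation, so nonnegative sums are enough.\<close>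

lemma goldbach_three_summands:
  assumes "goldbach_conjecture"
  shows "\<exists>ss. set ss \<subseteq> power_gens {p. prime p} \<and> length ss \<le> 3 \<and> z = sum_list ss"
proof (cases "z \<ge> 0")
  case True
  then show ?thesis
    using goldbach_three_summands_nat[OF assms, of "nat z"] by simp
next
  case False
  then obtain ss where ss: "set ss \<subseteq> power_gens {p. prime p}" "length ss \<le> 3" "- z = sum_list ss"
    using goldbach_three_summands_nat[OF assms, of "nat (- z)"] by auto
  have "z = sum_list (map uminus ss)"
    using ss(3) uminus_sum_list_map[of "\<lambda>x. x" ss] by (simp add: o_def)
  with ss show ?thesis
    by (intro exI[of _ "map uminus ss"]) (auto intro: power_gens_uminus)
qed

section \<open>Covering certificates\<close>

text \<open>The triple \<open>(q, t, j)\<close> certifies that no \<open>c * 2 ^ k + s * p ^ b\<close> with \<open>k\<close> in the class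
  \<open>r\<close> modulo \<open>d\<close> is congruent to \<open>n\<close> modulo \<open>q\<close>. Modulo \<open>q\<close> the powers of 2 have period \<open>d * t\<close>
  and those of \<open>p\<close> have period \<open>j\<close>, so \<open>t\<close> exponents of 2 within the class and \<open>j\<close>
  exponents of \<open>p\<close> represent all of them. Quantifying over lists of numbers makes the
  condition executable by rewriting.\<close>

definition avoids_mod ::
    "int \<Rightarrow> int \<Rightarrow> nat \<Rightarrow> nat \<Rightarrow> nat \<Rightarrow> int \<Rightarrow> int \<times> nat \<times> nat \<Rightarrow> bool" where
  "avoids_mod n c p d r s = (\<lambda>(q, t, j).
     t > 0 \<and> j > 0 \<and> 2 ^ (d * t) mod q = 1 \<and> int p ^ j mod q = 1 \<and>
     (\<forall>i\<in>set [0..<t]. \<forall>b\<in>set [0..<j]. (c * 2 ^ (r + d * i) + s * int p ^ b) mod q \<noteq> n mod q))"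

text \<open>In an entry \<open>(p, d, r, u, v)\<close> the exponents congruent to \<open>r\<close> modulo \<open>d\<close> are assigned to the
  prime \<open>p\<close>; \<open>u\<close> and \<open>v\<close> are the certificates against the powers \<open>p ^ b\<close> and \<open>- (p ^ b)\<close>.\<close>

type_synonym covering_class =
  "nat \<times> nat \<times> nat \<times> (int \<times> nat \<times> nat) \<times> (int \<times> nat \<times> nat)"

definition class_ok :: "int \<Rightarrow> int \<Rightarrow> covering_class \<Rightarrow> bool" where
  "class_ok n c = (\<lambda>(p, d, r, u, v).
     prime p \<and> 2 ^ d mod int p = 1 \<and> (n - c * 2 ^ r) mod int p = 0 \<and>
     avoids_mod n c p d r 1 u \<and> avoids_mod n c p d r (-1) v)"

definition covers :: "nat \<Rightarrow> covering_class list \<Rightarrow> bool" where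
  "covers L cs \<longleftrightarrow> L > 0 \<and>
     (\<forall>k\<in>set [0..<L]. \<exists>(p, d, r, u, v)\<in>set cs. d dvd L \<and> k mod d = r)"

lemma cong_power_mod_exponent:
  fixes a q :: int
  assumes "a ^ d mod q = 1"
  shows "[a ^ m = a ^ (m mod d)] (mod q)"
proof -
  have "[a ^ d = 1] (mod q)"
    using assms by (metis cong_def mod_mod_trivial)
  then have "[(a ^ d) ^ (m div d) * a ^ (m mod d) = 1 ^ (m div d) * a ^ (m mod d)] (mod q)"
    by (intro cong_mult cong_pow cong_refl)
  then show ?thesis
    by (simp flip: power_mult power_add)
qed

lemma avoids_modD:
  assumes "avoids_mod n c p d r s u" and "k mod d = r"
  shows "n \<noteq> c * 2 ^ k + s * int p ^ b"
proof -
  obtain q t j where u: "u = (q, t, j)"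
    by (metis prod_cases3)
  have pos: "t > 0" "j > 0" and two: "2 ^ (d * t) mod q = 1" and p: "int p ^ j mod q = 1"
    and avoid: "\<And>i b. i < t \<Longrightarrow> b < j \<Longrightarrow> (c * 2 ^ (r + d * i) + s * int p ^ b) mod q \<noteq> n mod q"
    using assms(1) by (auto simp: avoids_mod_def u)
  define i where "i = k div d mod t"
  have "k mod (d * t) = r + d * i"
    using assms(2) by (simp add: mod_mult2_eq i_def add.commute)
  then have "[c * 2 ^ k + s * int p ^ b = c * 2 ^ (r + d * i) + s * int p ^ (b mod j)] (mod q)"
    using cong_power_mod_exponent[OF two, of k] cong_power_mod_exponent[OF p, of b]
    by (intro cong_add cong_mult cong_refl) simp_all
  moreover have "i < t" "b mod j < j"
    using pos by (simp_all add: i_def)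
  ultimately show ?thesis
    using avoid by (metis cong_def)
qed

text \<open>The prime \<open>p\<close> of the class divides \<open>n - c * 2 ^ k\<close>. If this were a signed power of a prime
  \<open>p'\<close>, then \<open>p' = p\<close>, which the certificates exclude. The exponent \<open>b = 0\<close> needs no
  separate treatment, as \<open>p\<close> does not divide 1.\<close>

lemma class_okD:
  assumes ok: "class_ok n c (p, d, r, u, v)" and k: "k mod d = r"
    and "prime p'" and s: "s = 1 \<or> s = - 1"
  shows "n \<noteq> c * 2 ^ k + s * int p' ^ b"
proof
  assume n: "n = c * 2 ^ k + s * int p' ^ b"
  have "prime p" and two: "2 ^ d mod int p = 1" and r: "int p dvd n - c * 2 ^ r"
    using ok by (auto simp: class_ok_def)
  have "[2 ^ k = 2 ^ r] (mod int p)"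
    using cong_power_mod_exponent[OF two, of k] k by simp
  then have "[n - c * 2 ^ k = n - c * 2 ^ r] (mod int p)"
    by (intro cong_diff cong_mult cong_refl)
  then have "int p dvd n - c * 2 ^ k"
    using r cong_dvd_iff by blast
  then have "int p dvd int p' ^ b"
    using n s by auto
  then have "p dvd p'"
    using \<open>prime p\<close> by (metis of_nat_dvd_iff of_nat_power prime_dvd_power)
  then have "p' = p"
    using \<open>prime p\<close> \<open>prime p'\<close> by (metis primes_dvd_imp_eq)
  moreover have "avoids_mod n c p d r s u \<or> avoids_mod n c p d r s v"
    using ok s by (auto simp: class_ok_def)
  ultimately show False
    using avoids_modD k n by metis
qed

lemma covers_imp_not_sum:
  assumes "covers L cs" and "list_all (class_ok n c) cs"
    and "prime p" and "s = 1 \<or> s = - 1"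
  shows "n \<noteq> c * 2 ^ k + s * int p ^ b"
proof -
  have "k mod L \<in> set [0..<L]"
    using assms(1) by (simp add: covers_def)
  then obtain p' d r u v
    where cls: "(p', d, r, u, v) \<in> set cs" and "d dvd L" "k mod L mod d = r"
    using assms(1) unfolding covers_def by blast
  then have k: "k mod d = r"
    by (simp add: mod_mod_cancel)
  have "class_ok n c (p', d, r, u, v)"
    using assms(2) cls unfolding list_all_iff by (rule bspec)
  then show ?thesis
    using k assms(3,4) by (rule class_okD)
qed

section \<open>An integer that is not the sum of two signed prime powers\<close>

text \<open>Following Z.-W. Sun (On integers not of the form \<open>\<plusminus>p^a \<plusminus> q^b\<close>, 2000), the witness is
  taken in the residue class of 47867742232066880047611079 modulo
  66483084961588510124010691590, the product of 2 and the 18 primes in the tables below. Being in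
  this class makes the witness odd and makes the congruences modulo the primes \<open>p\<close> hold. The number
  47867742232066880047611079 is itself prime, hence a generator; adding the modulus 68 times
  gives an element of the class that is divisible by 53 and 79. The certificates against powers
  of \<open>p\<close> were found for this element by searching small odd moduli \<open>q\<close> for those in which few
  pairs of exponents have to be compared.\<close>

definition witness :: int where
  "witness = 4520897645130250755312774639199"

definition pos_classes :: "covering_class list" where
  "pos_classes = [
     (3, 2, 0, (13, 6, 3), (91, 6, 6)),
     (7, 3, 0, (3, 2, 1), (57, 6, 3)),
     (11, 10, 3, (63, 3, 6), (5, 2, 1)),
     (19, 18, 11, (3, 1, 1), (189, 1, 6)),
     (31, 5, 2, (3, 2, 1), (5, 4, 1)),
     (37, 36, 35, (3, 1, 1), (19, 1, 2)),
     (41, 20, 1, (5, 1, 1), (5, 1, 1)),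
     (61, 60, 31, (3, 1, 1), (5, 1, 1)),
     (73, 9, 5, (3, 2, 1), (37, 4, 2)),
     (109, 36, 17, (3, 1, 1), (27, 1, 1)),
     (151, 15, 4, (3, 2, 1), (5, 4, 1)),
     (331, 30, 25, (3, 1, 1), (11, 1, 1))]"

definition neg_classes :: "covering_class list" where
  "neg_classes = [
     (3, 2, 1, (85, 4, 16), (91, 6, 6)),
     (5, 4, 0, (39, 3, 4), (51, 2, 16)),
     (13, 12, 10, (3, 1, 1), (7, 1, 2)),
     (17, 8, 6, (13, 3, 6), (15, 1, 4)),
     (97, 48, 2, (3, 1, 1), (7, 1, 2)),
     (241, 24, 18, (3, 1, 1), (5, 1, 1)),
     (257, 16, 10, (13, 3, 6), (15, 1, 4))]"

lemma covers_pos: "covers 180 pos_classes"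
  by code_simp

lemma covers_neg: "covers 48 neg_classes"
  by code_simp

lemma pos_classes_ok: "list_all (class_ok witness 1) pos_classes"
  by code_simp

lemma neg_classes_ok: "list_all (class_ok witness (-1)) neg_classes"
  by code_simp

lemma witness_not_pm_two_power_plus:
  assumes "prime p" and "s = 1 \<or> s = - 1" and "c = 1 \<or> c = - 1"
  shows "witness \<noteq> c * 2 ^ k + s * int p ^ b"
  using assms(3) covers_imp_not_sum[OF covers_pos pos_classes_ok assms(1,2)]
    covers_imp_not_sum[OF covers_neg neg_classes_ok assms(1,2)] by (elim disjE) simp_all

lemma power_gens_primesE:
  assumes "x \<in> power_gens {p. prime p}"
  obtains p s b where "prime p" "s = 1 \<or> s = - 1" "x = s * int p ^ b"
  using assms unfolding power_gens_def by fastforce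

lemma even_power_gens_primesE:
  assumes "x \<in> power_gens {p. prime p}" and "even x"
  obtains c k where "c = 1 \<or> c = - 1" "x = c * 2 ^ k"
proof -
  obtain p s b where "prime p" "s = 1 \<or> s = - 1" "x = s * int p ^ b"
    using assms(1) by (rule power_gens_primesE)
  moreover from this have "even p"
    using assms(2) by auto
  then have "p = 2"
    using \<open>prime p\<close> primes_dvd_imp_eq two_is_prime_nat by blast
  ultimately show ?thesis
    using that[of s b] by simp
qed

lemma witness_not_sum_of_two:
  assumes "x \<in> power_gens {p. prime p}" and "y \<in> power_gens {p. prime p}"
  shows "witness \<noteq> x + y"
proof -
  have *: "witness \<noteq> x + y"
    if "x \<in> power_gens {p. prime p}" "y \<in> power_gens {p. prime p}" "even x" for x y
    using that by (metis even_power_gens_primesE power_gens_primesE witness_not_pm_two_power_plus)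
  have "odd witness"
    by (simp add: witness_def)
  then show ?thesis
    using *[of x y] *[of y x] assms by (metis add.commute odd_add)
qed

lemma witness_not_generator: "witness \<notin> power_gens {p. prime p}"
proof
  assume "witness \<in> power_gens {p. prime p}"
  then obtain p s b where "prime p" and s: "s = 1 \<or> s = - 1" and w: "witness = s * int p ^ b"
    by (rule power_gens_primesE)
  have factor: "q = p" if "prime q" "int q dvd witness" for q
  proof -
    have "int p ^ b = s * witness"
      using w s by auto
    then have "int q dvd int p ^ b"
      using that by simp
    then have "q dvd p"
      using \<open>prime q\<close> by (metis of_nat_dvd_iff of_nat_power prime_dvd_power)
    then show ?thesis
      using \<open>prime q\<close> \<open>prime p\<close> by (metis primes_dvd_imp_eq)
  qed
  have "53 = p"
    by (rule factor) (simp_all add: witness_def)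
  moreover have "79 = p"
    by (rule factor) (simp_all add: witness_def)
  ultimately show False
    by simp
qed

text \<open>The upper bound is attained between 0 and the witness.\<close>

theorem mainTheorem4:
  assumes "goldbach_conjecture"
  shows "graph_diameter (power_cayley {p. prime p}) = 3"
proof (rule antisym)
  have "graph_dist (power_cayley {p. prime p}) x y \<le> 3" for x y
  proof -
    obtain ss where ss: "set ss \<subseteq> power_gens {p. prime p}" "length ss \<le> 3" "y - x = sum_list ss"
      using goldbach_three_summands[OF assms] by blast
    then have "graph_dist (power_cayley {p. prime p}) x y \<le> length ss"
      by (intro graph_dist_power_cayley_le) auto
    also have "\<dots> \<le> ereal 3"
      using ss(2) by simp
    finally show ?thesis by simp
  qed
  then show "graph_diameter (power_cayley {p. prime p}) \<le> 3"
    unfolding graph_diameter_def by (intro SUP_least)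
next
  have "graph_dist (power_cayley {p. prime p}) 0 witness \<ge> (3::nat)"
  proof (rule graph_dist_power_cayley_ge)
    fix ss assume ss: "set ss \<subseteq> power_gens {p. prime p}" "witness = 0 + sum_list ss"
    show "3 \<le> length ss"
    proof (rule ccontr)
      assume "\<not> 3 \<le> length ss"
      then consider "ss = []" | x where "ss = [x]" | x y where "ss = [x, y]"
        by (cases ss rule: remdups_adj.cases) (auto simp: Suc_le_eq)
      then show False
      proof cases
        case 1
        then show False using ss by (simp add: witness_def)
      next
        case 2
        then show False using ss witness_not_generator by simp
      next
        case 3
        then show False using ss witness_not_sum_of_two by simp
      qed
    qed
  qed
  then show "3 \<le> graph_diameter (power_cayley {p. prime p})"
    unfolding graph_diameter_def
    by (intro SUP_upper2[of 0] SUP_upper2[of witness])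
       (simp_all add: power_cayley_simps)
qed

end
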